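(* Let $m \ge 1$ and $n \ge 1$ be integers and let $A = \{0,1,\ldots,m-1\}$. Let $P(X_1,\ldots,X_n) \in \mathbb{R}[X_1,\ldots,X_n]$ be a polynomial that weakly sign represents the parity function over $A^n$, and suppose that the degree of $P$ in each variable $X_i$ is at most $m-1$. Then the sparsity of $P$ is at least $(m-1)^n$.
   Context: For $A \subseteq \mathbb{Z}$, the parity function $\mathrm{Par}: A^n \to \{0,1\}$ is $\mathrm{Par}(a_1,\ldots,a_n) = \sum_{i=1}^n a_i \bmod 2$. A polynomial $P \in \mathbb{R}[X_1,\ldots,X_n]$ weakly sign represents $f: A^n \to \{0,1\}$ if for every $a \in A^n$: $f(a) = 0 \Rightarrow P(a) \ge 0$ and $f(a) = 1 \Rightarrow P(a) \le 0$, and moreover $P$ does not vanish identically on $A^n$ (i.e. $P(a) \neq 0$ for some $a \in A^n$). The sparsity of $P$ is the number of monomials with nonzero coefficient in the standard monomial basis. The degree of $P$ in $X_i$ is the largest exponent of $X_i$ among monomials with nonzero coefficient. *)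

theory Defs
  imports Complex_Main "HOL-Library.Poly_Mapping" "HOL-Library.FuncSet"
begin

text \<open>
  A polynomial is its finitely supported family of coefficients, indexed by
  monomials; a monomial is a finitely supported family of exponents.  The variable
  \<open>X\<^sub>i\<close> has index \<open>i\<close>, and \<open>polys_in n\<close> is the ring in the variables
  \<open>X\<^sub>1, \<dots>, X\<^sub>n\<close>.
\<close>

type_synonym monomial = "nat \<Rightarrow>\<^sub>0 nat"
type_synonym real_mpoly = "monomial \<Rightarrow>\<^sub>0 real"

definition polys_in :: "nat \<Rightarrow> real_mpoly set" where
  "polys_in n = {P. \<forall>u \<in> Poly_Mapping.keys P. Poly_Mapping.keys u \<subseteq> {1..n}}"

definition eval_mpoly :: "real_mpoly \<Rightarrow> (nat \<Rightarrow> real) \<Rightarrow> real" where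
  "eval_mpoly P x = (\<Sum>u \<in> Poly_Mapping.keys P. Poly_Mapping.lookup P u * (\<Prod>i \<in> Poly_Mapping.keys u. x i ^ Poly_Mapping.lookup u i))"

definition sparsity :: "real_mpoly \<Rightarrow> nat" where
  "sparsity P = card (Poly_Mapping.keys P)"

text \<open>The inserted \<open>0\<close> only matters for the zero polynomial, which gets degree \<open>0\<close>.\<close>

definition degree_in :: "real_mpoly \<Rightarrow> nat \<Rightarrow> nat" where
  "degree_in P i = Max (insert 0 ((\<lambda>u. Poly_Mapping.lookup u i) ` Poly_Mapping.keys P))"

text \<open>The points of \<open>A\<^sup>n\<close> are the extensional functions on \<open>{1..n}\<close> with values in \<open>A\<close>.\<close>

definition cube :: "int set \<Rightarrow> nat \<Rightarrow> (nat \<Rightarrow> int) set" where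
  "cube A n = {1..n} \<rightarrow>\<^sub>E A"

definition parity :: "nat \<Rightarrow> (nat \<Rightarrow> int) \<Rightarrow> int" where
  "parity n a = (\<Sum>i = 1..n. a i) mod 2"

definition weakly_sign_represents ::
  "real_mpoly \<Rightarrow> int set \<Rightarrow> nat \<Rightarrow> ((nat \<Rightarrow> int) \<Rightarrow> int) \<Rightarrow> bool" where
  "weakly_sign_represents P A n f \<longleftrightarrow>
     (\<forall>a \<in> cube A n.
        (f a = 0 \<longrightarrow> eval_mpoly P (\<lambda>i. real_of_int (a i)) \<ge> 0) \<and>
        (f a = 1 \<longrightarrow> eval_mpoly P (\<lambda>i. real_of_int (a i)) \<le> 0)) \<and>
     (\<exists>a \<in> cube A n. eval_mpoly P (\<lambda>i. real_of_int (a i)) \<noteq> 0)"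

end

theory Submission
  imports Defs "HOL-Computational_Algebra.Polynomial"
begin

text \<open>
  Every monomial with all \<open>n\<close> exponents in \<open>{1..m - 1}\<close> occurs in \<open>P\<close>.  Interpolating on the grid
  writes the coefficient of \<open>u\<close> as the sum over grid points \<open>a\<close> of \<open>P(a)\<close> times the product
  of the coefficients of \<open>X ^ u\<^sub>i\<close> in the Lagrange polynomial of the node \<open>a\<^sub>i\<close>.  As the
  nodes are nonnegative, that coefficient has sign \<open>(- 1) ^ (a\<^sub>i + u\<^sub>i)\<close>, so the parity
  sign of \<open>P(a)\<close> cancels and all terms of the sum have the sign \<open>(- 1) ^ (u\<^sub>1 + \<dots> + u\<^sub>n)\<close>.
\<close>

section \<open>Lagrange interpolation over a field\<close>

definition lagrange_basis :: "'i set \<Rightarrow> ('i \<Rightarrow> 'a::field) \<Rightarrow> 'i \<Rightarrow> 'a poly" where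
  "lagrange_basis I x a =
     smult (inverse (\<Prod>b\<in>I - {a}. x a - x b)) (\<Prod>b\<in>I - {a}. [:- x b, 1:])"

lemma poly_lagrange_basis:
  fixes x :: "'i \<Rightarrow> 'a::field"
  assumes "finite I" "inj_on x I" "a \<in> I" "b \<in> I"
  shows "poly (lagrange_basis I x a) (x b) = (if a = b then 1 else 0)"
proof (cases "a = b")
  case True
  have "(\<Prod>c\<in>I - {b}. x b - x c) \<noteq> 0"
    using assms by (auto dest: inj_onD)
  then show ?thesis
    using True by (simp add: lagrange_basis_def poly_prod)
next
  case False
  then have "(\<Prod>c\<in>I - {a}. x b - x c) = 0"
    using assms by (intro prod_zero) auto
  then show ?thesis
    using False by (simp add: lagrange_basis_def poly_prod)
qed

lemma degree_lagrange_basis: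
  assumes "finite I" "a \<in> I"
  shows "degree (lagrange_basis I x a) < card I"
proof -
  have "degree (lagrange_basis I x a) \<le> degree (\<Prod>b\<in>I - {a}. [:- x b, 1:])"
    unfolding lagrange_basis_def by (rule degree_smult_le)
  also have "\<dots> = card (I - {a})"
    by (subst degree_prod_sum_eq) auto
  also have "\<dots> < card I"
    using assms by (rule card_Diff1_less)
  finally show ?thesis .
qed

text \<open>The difference \<open>q\<close> of the two sides has degree below \<open>card I\<close>
  but vanishes at all \<open>card I\<close> distinct nodes, so it is zero.\<close>

lemma lagrange_interpolation:
  fixes p :: "'a::field poly"
  assumes "finite I" "inj_on x I" "degree p < card I"
  shows "p = (\<Sum>a\<in>I. smult (poly p (x a)) (lagrange_basis I x a))"
proof (rule ccontr)
  define q where "q = p - (\<Sum>a\<in>I. smult (poly p (x a)) (lagrange_basis I x a))"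
  assume "p \<noteq> (\<Sum>a\<in>I. smult (poly p (x a)) (lagrange_basis I x a))"
  then have "q \<noteq> 0"
    by (simp add: q_def)
  have "degree (\<Sum>a\<in>I. smult (poly p (x a)) (lagrange_basis I x a)) < card I"
  proof (rule degree_sum_less)
    show "degree (smult (poly p (x a)) (lagrange_basis I x a)) < card I" if "a \<in> I" for a
      using degree_smult_le degree_lagrange_basis[OF assms(1) that] by (rule le_less_trans)
  qed (use assms in auto)
  then have deg: "degree q < card I"
    unfolding q_def using assms(3) by (intro degree_diff_less)
  have "x ` I \<subseteq> {z. poly q z = 0}"
  proof safe
    fix b assume "b \<in> I"
    have "(\<Sum>a\<in>I. poly p (x a) * poly (lagrange_basis I x a) (x b)) =
          (\<Sum>a\<in>I. if a = b then poly p (x b) else 0)"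
      using assms \<open>b \<in> I\<close> by (intro sum.cong) (auto simp: poly_lagrange_basis)
    then show "poly q (x b) = 0"
      using assms \<open>b \<in> I\<close> by (simp add: q_def poly_sum)
  qed
  then have "card I \<le> card {z. poly q z = 0}"
    using poly_roots_finite[OF \<open>q \<noteq> 0\<close>] assms(2) by (metis card_image card_mono)
  also have "\<dots> \<le> degree q"
    using \<open>q \<noteq> 0\<close> by (rule card_poly_roots_bound)
  finally show False
    using deg by simp
qed

text \<open>The coefficients of the Lagrange polynomials form the inverse of the Vandermonde matrix:
  interpolation reproduces \<open>monom 1 v\<close> exactly, and the coefficients at
  \<open>k\<close> are compared.\<close>

lemma sum_power_mult_coeff_lagrange_basis:
  fixes x :: "'i \<Rightarrow> 'a::field"
  assumes "finite I" "inj_on x I" "v < card I"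
  shows "(\<Sum>a\<in>I. x a ^ v * coeff (lagrange_basis I x a) k) = (if v = k then 1 else 0)"
proof -
  have "degree (monom 1 v :: 'a poly) < card I"
    using assms(3) by (simp add: degree_monom_eq)
  from lagrange_interpolation[OF assms(1,2) this]
  have "coeff (monom 1 v) k = coeff (\<Sum>a\<in>I. smult (x a ^ v) (lagrange_basis I x a)) k"
    by (simp add: poly_monom)
  then show ?thesis
    by (simp add: coeff_sum)
qed

section \<open>Signs of the coefficients of Lagrange polynomials\<close>

text \<open>Up to sign the coefficients are elementary symmetric functions of positive numbers. In
  the induction, the two terms contributed by a new linear factor have the same sign and cannot
  cancel.\<close>

lemma coeff_prod_linear_sign:
  fixes x :: "'i \<Rightarrow> real"
  assumes "finite S" "\<And>b. b \<in> S \<Longrightarrow> x b > 0" "k \<le> card S"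
  shows "(- 1) ^ (card S + k) * coeff (\<Prod>b\<in>S. [:- x b, 1:]) k > 0"
  using assms
proof (induction S arbitrary: k rule: finite_induct)
  case empty
  then show ?case by simp
next
  case (insert c S)
  let ?p = "\<Prod>b\<in>S. [:- x b, 1:]"
  have rec: "coeff (\<Prod>b\<in>insert c S. [:- x b, 1:]) k =
      - x c * coeff ?p k + (if k = 0 then 0 else coeff ?p (k - 1))"
    using insert.hyps by (simp add: coeff_pCons split: nat.split)
  have deg: "degree ?p = card S"
    by (subst degree_prod_sum_eq) auto
  have c: "x c > 0"
    using insert.prems by simp
  have fst: "(- 1) ^ (card S + k) * coeff ?p k * x c > 0" if "k \<le> card S"
    using insert.IH[OF _ that] insert.prems c by simp
  have snd: "(- 1) ^ (card S + (k - 1)) * coeff ?p (k - 1) > 0" if "k > 0"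
    using insert.IH[of "k - 1"] insert.prems insert.hyps that by simp
  \<comment> \<open>At the two ends only one term of \<open>rec\<close> survives: for
    \<open>k = 0\<close> there is no shifted term, and for \<open>k = Suc (card S)\<close> the index
    exceeds the degree of \<open>?p\<close>.\<close>
  consider "k = 0" | "k > 0" "k \<le> card S" | "k = Suc (card S)"
    using insert.prems insert.hyps by (auto simp: le_Suc_eq)
  then show ?case
  proof cases
    case 1
    then show ?thesis
      using fst insert.hyps rec by (simp add: algebra_simps)
  next
    case 2
    then show ?thesis
      using fst snd insert.hyps unfolding rec by (cases k) (auto simp: algebra_simps)
  next
    case 3
    then show ?thesis
      using snd insert.hyps unfolding rec by (simp add: coeff_eq_0 deg)
  qed
qed

lemma sgn_prod: "sgn (\<Prod>i\<in>I. f i) = (\<Prod>i\<in>I. sgn (f i :: 'a::linordered_field))"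
  by (induction I rule: infinite_finite_induct) (simp_all add: sgn_mult)

lemma sgn_mult_inverse_pos: "0 < sgn x * inverse x" if "x \<noteq> 0" for x :: "'a::linordered_field"
  using that by (cases x "0 :: 'a" rule: linorder_cases) simp_all

text \<open>Only the \<open>m - 1 - nat a\<close> nodes above \<open>a\<close> give negative
  factors.\<close>

lemma sgn_prod_int_diff:
  fixes a :: int
  assumes "0 \<le> a" "a < int m"
  shows "sgn (\<Prod>b\<in>{0..int m - 1} - {a}. real_of_int a - real_of_int b) = (- 1) ^ (m - 1 - nat a)"
proof -
  have split: "{0..int m - 1} - {a} = {0..<a} \<union> {a<..int m - 1}"
    using assms by auto
  have "sgn (\<Prod>b\<in>{0..int m - 1} - {a}. real_of_int a - real_of_int b) =
      (\<Prod>b\<in>{0..<a}. sgn (real_of_int a - real_of_int b)) *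
      (\<Prod>b\<in>{a<..int m - 1}. sgn (real_of_int a - real_of_int b))"
    unfolding split by (subst prod.union_disjoint) (auto simp: sgn_mult sgn_prod)
  also have "(\<Prod>b\<in>{0..<a}. sgn (real_of_int a - real_of_int b)) = 1"
    by (intro prod.neutral) auto
  also have "(\<Prod>b\<in>{a<..int m - 1}. sgn (real_of_int a - real_of_int b)) =
      (\<Prod>b\<in>{a<..int m - 1}. - 1)"
    by (intro prod.cong) auto
  also have "\<dots> = (- 1) ^ (m - 1 - nat a)"
  proof -
    have "nat (int m - 1 - a) = m - 1 - nat a"
      using assms by linarith
    then show ?thesis by simp
  qed
  finally show ?thesis by simp
qed

text \<open>The numerator contributes the sign \<open>(- 1) ^ (m - 1 + k)\<close> and the
  denominator \<open>(- 1) ^ (m - 1 - nat a)\<close>; the exponents add up to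
  \<open>nat a + k\<close> modulo 2. The bound \<open>1 \<le> k\<close> excludes the constant
  coefficient, which is zero for \<open>a \<noteq> 0\<close>.\<close>

lemma coeff_lagrange_basis_sign:
  fixes a :: int
  assumes "0 \<le> a" "a < int m" "1 \<le> k" "k < m"
  shows "(- 1) ^ (nat a + k) * coeff (lagrange_basis {0..int m - 1} real_of_int a) k > 0"
proof -
  let ?I = "{0..int m - 1}"
  let ?D = "\<Prod>b\<in>?I - {a}. real_of_int a - real_of_int b"
  let ?p = "\<Prod>b\<in>?I - {a}. [:- real_of_int b, 1:]"
  have p: "(- 1) ^ (m - 1 + k) * coeff ?p k > 0"
  proof (cases "a = 0")
    case True
    then have "card (?I - {a}) = m - 1"
      using assms by (simp add: card_Diff_subset)
    then show ?thesis
      using coeff_prod_linear_sign[of "?I - {a}" real_of_int k] True assms by force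
  next
    case False
    \<comment> \<open>The node 0 is not positive, so it is split off. Its factor is X, which merely
      shifts the index from \<open>k - 1\<close> to \<open>k\<close>.\<close>
    let ?S = "?I - {a} - {0}"
    have card: "card ?S = m - 2"
      using assms False by (simp add: card_Diff_subset)
    have "?p = [:- real_of_int 0, 1:] * (\<Prod>b\<in>?S. [:- real_of_int b, 1:])"
      using assms False by (intro prod.remove) auto
    then have "coeff ?p k = coeff (\<Prod>b\<in>?S. [:- real_of_int b, 1:]) (k - 1)"
      using assms by (simp add: coeff_pCons split: nat.split)
    moreover have "(- 1) ^ (card ?S + (k - 1)) *
        coeff (\<Prod>b\<in>?S. [:- real_of_int b, 1:]) (k - 1) > 0"
      using assms card by (intro coeff_prod_linear_sign) auto
    moreover have "m - 1 + k = m - 2 + (k - 1) + 2"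
      using assms by simp
    ultimately show ?thesis
      by (simp add: card)
  qed
  have D: "sgn ?D = (- 1) ^ (m - 1 - nat a)"
    using assms by (intro sgn_prod_int_diff)
  then have "?D \<noteq> 0"
    by (metis power_eq_0_iff sgn_0 neg_equal_0_iff_equal zero_neq_one)
  then have "0 < sgn ?D * inverse ?D"
    by (rule sgn_mult_inverse_pos)
  from mult_pos_pos[OF this p]
  have "0 < ((- 1) ^ (m - 1 - nat a) * (- 1) ^ (m - 1 + k)) * (inverse ?D * coeff ?p k)"
    by (simp add: D mult_ac)
  also have "(- 1 :: real) ^ (m - 1 - nat a) * (- 1) ^ (m - 1 + k) = (- 1) ^ (nat a + k)"
    using assms by (simp flip: power_add) (simp add: minus_one_power_iff, presburger)
  finally show ?thesis
    by (simp add: lagrange_basis_def)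
qed

section \<open>Recovering coefficients from values on a grid\<close>

lemma lookup_le_degree_in:
  assumes "u \<in> Poly_Mapping.keys P"
  shows "Poly_Mapping.lookup u i \<le> degree_in P i"
  unfolding degree_in_def using assms by (intro Max_ge) auto

lemma eval_mpoly_polys_in:
  assumes "P \<in> polys_in n"
  shows "eval_mpoly P x = (\<Sum>u\<in>Poly_Mapping.keys P.
    Poly_Mapping.lookup P u * (\<Prod>i = 1..n. x i ^ Poly_Mapping.lookup u i))"
proof -
  have "(\<Prod>i\<in>Poly_Mapping.keys u. x i ^ Poly_Mapping.lookup u i) =
        (\<Prod>i = 1..n. x i ^ Poly_Mapping.lookup u i)" if "u \<in> Poly_Mapping.keys P" for u
    using assms that by (intro prod.mono_neutral_left) (auto simp: polys_in_def in_keys_iff)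
  then show ?thesis
    by (simp add: eval_mpoly_def)
qed

text \<open>After expanding \<open>P\<close> into monomials and swapping sums, the sum over the grid
  factors into one sum per variable. Each of these is a Kronecker delta of exponents, so only the
  monomial \<open>u\<close> survives.\<close>

lemma lookup_eq_sum_cube:
  fixes P :: real_mpoly
  assumes "finite A" "P \<in> polys_in n" "\<And>i. i \<in> {1..n} \<Longrightarrow> degree_in P i < card A"
    and "Poly_Mapping.keys u \<subseteq> {1..n}"
  shows "Poly_Mapping.lookup P u = (\<Sum>a\<in>cube A n. eval_mpoly P (\<lambda>i. real_of_int (a i)) *
    (\<Prod>i = 1..n. coeff (lagrange_basis A real_of_int (a i)) (Poly_Mapping.lookup u i)))"
proof -
  let ?c = "\<lambda>a k. coeff (lagrange_basis A real_of_int a) k"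
  let ?K = "Poly_Mapping.keys P" and ?l = "Poly_Mapping.lookup"
  have "(\<Sum>a\<in>cube A n. eval_mpoly P (\<lambda>i. real_of_int (a i)) * (\<Prod>i = 1..n. ?c (a i) (?l u i)))
      = (\<Sum>a\<in>cube A n. \<Sum>v\<in>?K. ?l P v * (\<Prod>i = 1..n. real_of_int (a i) ^ ?l v i * ?c (a i) (?l u i)))"
    by (simp add: eval_mpoly_polys_in[OF assms(2)] sum_distrib_right prod.distrib mult.assoc)
  also have "\<dots> = (\<Sum>v\<in>?K. ?l P v *
      (\<Sum>a\<in>cube A n. \<Prod>i = 1..n. real_of_int (a i) ^ ?l v i * ?c (a i) (?l u i)))"
    by (subst sum.swap) (simp add: sum_distrib_left)
  also have "\<dots> = (\<Sum>v\<in>?K. ?l P v * (\<Prod>i = 1..n. \<Sum>z\<in>A. real_of_int z ^ ?l v i * ?c z (?l u i)))"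
    unfolding cube_def using assms(1) by (subst prod_sum_PiE) auto
  also have "\<dots> = (\<Sum>v\<in>?K. if v = u then ?l P v else 0)"
  proof (intro sum.cong refl)
    fix v assume v: "v \<in> ?K"
    have "(\<Prod>i = 1..n. \<Sum>z\<in>A. real_of_int z ^ ?l v i * ?c z (?l u i)) =
        (\<Prod>i = 1..n. if ?l v i = ?l u i then 1 else 0)"
      using assms(1,3) lookup_le_degree_in[OF v]
      by (intro prod.cong refl sum_power_mult_coeff_lagrange_basis)
        (auto intro: le_less_trans simp: inj_on_def)
    also have "\<dots> = (if v = u then 1 else 0)"
    proof (cases "v = u")
      case False
      then obtain i where i: "?l v i \<noteq> ?l u i"
        by (meson poly_mapping_eqI)
      \<comment> \<open>Unequal exponents cannot both be 0, so \<open>i\<close> is a variable of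
        \<open>u\<close> or \<open>v\<close>; hence the product over \<open>{1..n}\<close> contains
        the zero factor at \<open>i\<close>.\<close>
      then have "i \<in> Poly_Mapping.keys v \<union> Poly_Mapping.keys u"
        by (auto simp: in_keys_iff)
      then have "i \<in> {1..n}"
        using v assms(2,4) unfolding polys_in_def by blast
      then show ?thesis
        using i False by auto
    qed simp
    finally show "?l P v * (\<Prod>i = 1..n. \<Sum>z\<in>A. real_of_int z ^ ?l v i * ?c z (?l u i)) =
        (if v = u then ?l P v else 0)"
      by simp
  qed
  also have "\<dots> = ?l P u"
    by (simp add: in_keys_iff)
  finally show ?thesis ..
qed

section \<open>Parity signs and nonvanishing coefficients\<close>

lemma prod_minus_one_power_nat:
  assumes "\<And>i. i \<in> I \<Longrightarrow> 0 \<le> a i"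
  shows "(\<Prod>i\<in>I. (- 1 :: real) ^ nat (a i)) = (if even (\<Sum>i\<in>I. a i) then 1 else - 1)"
  using assms
  by (induction I rule: infinite_finite_induct) (auto simp: minus_one_power_iff even_nat_iff)

text \<open>The parity sign merges the two cases of the weak sign condition into one
  inequality.\<close>

lemma weakly_sign_represents_parity_nonneg:
  assumes "weakly_sign_represents P {0..int m - 1} n (parity n)" "a \<in> cube {0..int m - 1} n"
  shows "0 \<le> (\<Prod>i = 1..n. (- 1) ^ nat (a i)) * eval_mpoly P (\<lambda>i. real_of_int (a i))"
proof -
  have "(\<Prod>i = 1..n. (- 1 :: real) ^ nat (a i)) = (if even (\<Sum>i = 1..n. a i) then 1 else - 1)"
    using assms(2) by (intro prod_minus_one_power_nat) (auto simp: cube_def PiE_iff)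
  then show ?thesis
    using assms unfolding weakly_sign_represents_def parity_def
    by (auto simp: even_iff_mod_2_eq_zero odd_iff_mod_2_eq_one)
qed

lemma weakly_sign_represents_parity_lookup_nonzero:
  assumes P: "P \<in> polys_in n"
    and rep: "weakly_sign_represents P {0..int m - 1} n (parity n)"
    and deg: "\<And>i. i \<in> {1..n} \<Longrightarrow> degree_in P i < m"
    and u: "Poly_Mapping.keys u \<subseteq> {1..n}"
      "\<And>i. i \<in> {1..n} \<Longrightarrow> Poly_Mapping.lookup u i \<in> {1..<m}"
  shows "Poly_Mapping.lookup P u \<noteq> 0"
proof -
  let ?A = "{0..int m - 1}" and ?l = "Poly_Mapping.lookup"
  let ?c = "\<lambda>z k. coeff (lagrange_basis ?A real_of_int z) k"
  let ?e = "\<lambda>a. eval_mpoly P (\<lambda>i. real_of_int (a i))"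
  let ?s = "\<Prod>i = 1..n. (- 1 :: real) ^ ?l u i"
  let ?t = "\<lambda>a. ?s * (?e a * (\<Prod>i = 1..n. ?c (a i) (?l u i)))"
  have fin: "finite (cube ?A n)"
    by (simp add: cube_def finite_PiE)
  \<comment> \<open>The parity sign of \<open>a\<close> is inserted twice, which changes nothing:
    one copy makes the value of \<open>P\<close> nonnegative, the other makes the Lagrange
    coefficients positive.\<close>
  have t: "?t a = ((\<Prod>i = 1..n. (- 1) ^ nat (a i)) * ?e a) *
      (\<Prod>i = 1..n. (- 1) ^ (nat (a i) + ?l u i) * ?c (a i) (?l u i))" for a
  proof -
    have "(\<Prod>i = 1..n. (- 1 :: real) ^ nat (a i)) * (\<Prod>i = 1..n. (- 1) ^ nat (a i)) = 1"
      by (simp flip: prod.distrib power_add add: mult_2[symmetric])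
    then show ?thesis
      by (simp add: power_add prod.distrib mult_ac)
  qed
  have pos: "0 < (\<Prod>i = 1..n. (- 1) ^ (nat (a i) + ?l u i) * ?c (a i) (?l u i))"
    if "a \<in> cube ?A n" for a
  proof (rule prod_pos)
    fix i assume i: "i \<in> {1..n}"
    then have "a i \<in> ?A"
      using that by (auto simp: cube_def PiE_iff)
    then show "0 < (- 1) ^ (nat (a i) + ?l u i) * ?c (a i) (?l u i)"
      using u(2)[OF i] by (intro coeff_lagrange_basis_sign) auto
  qed
  have nonneg: "0 \<le> ?t a" if "a \<in> cube ?A n" for a
    unfolding t using weakly_sign_represents_parity_nonneg[OF rep that] less_imp_le[OF pos[OF that]]
    by (rule mult_nonneg_nonneg)
  \<comment> \<open>A grid point where \<open>P\<close> does not vanish makes the sum of nonnegative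
    terms strictly positive.\<close>
  obtain a where a: "a \<in> cube ?A n" "?e a \<noteq> 0"
    using rep by (auto simp: weakly_sign_represents_def)
  have "?t a \<noteq> 0"
    unfolding t using less_imp_neq[OF pos[OF a(1)]] a(2) by simp
  with nonneg[OF a(1)] have "0 < ?t a"
    by linarith
  with fin a(1) nonneg have "0 < (\<Sum>a\<in>cube ?A n. ?t a)"
    by (intro sum_pos2)
  also have "\<dots> = ?s * ?l P u"
    using lookup_eq_sum_cube[of ?A P n u] P deg u(1) by (simp add: sum_distrib_left)
  finally show ?thesis
    by auto
qed

theorem theorem3p11:
  fixes m n :: nat and P :: real_mpoly
  assumes "m \<ge> 1" and "n \<ge> 1"
    and "P \<in> polys_in n"
    and "weakly_sign_represents P {0..int m - 1} n (parity n)"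
    and "\<And>i. i \<in> {1..n} \<Longrightarrow> degree_in P i \<le> m - 1"
  shows "sparsity P \<ge> (m - 1) ^ n"
proof -
  \<comment> \<open>Extensional functions are \<open>undefined\<close> outside
    \<open>{1..n}\<close>, so exponents there are reset to 0 to obtain finite support.\<close>
  define mono :: "(nat \<Rightarrow> nat) \<Rightarrow> monomial"
    where "mono f = Abs_poly_mapping (\<lambda>i. if i \<in> {1..n} then f i else 0)" for f
  have mono: "Poly_Mapping.lookup (mono f) = (\<lambda>i. if i \<in> {1..n} then f i else 0)" for f
    unfolding mono_def by (rule Abs_poly_mapping_inverse)
      (auto intro: finite_subset[of _ "{1..n}"] split: if_splits)
  \<comment> \<open>Each of the \<open>n\<close> exponents has \<open>m - 1\<close> choices, which
    gives the bound.\<close>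
  let ?F = "{1..n} \<rightarrow>\<^sub>E {1..<m}"
  have "inj_on mono ?F"
  proof (rule inj_onI)
    fix f g assume fg: "f \<in> ?F" "g \<in> ?F" and eq: "mono f = mono g"
    show "f = g"
    proof (rule PiE_ext[OF fg])
      fix i assume "i \<in> {1..n}"
      then show "f i = g i"
        using fun_cong[OF arg_cong[OF eq, of Poly_Mapping.lookup], of i] by (simp add: mono)
    qed
  qed
  then have "card (mono ` ?F) = (m - 1) ^ n"
    by (simp add: card_image card_PiE)
  moreover have "mono ` ?F \<subseteq> Poly_Mapping.keys P"
  proof safe
    fix f assume f: "f \<in> ?F"
    have "Poly_Mapping.lookup P (mono f) \<noteq> 0"
    proof (rule weakly_sign_represents_parity_lookup_nonzero[OF assms(3,4)])
      show "degree_in P i < m" if "i \<in> {1..n}" for i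
        using assms(1) assms(5)[OF that] by simp
      show "Poly_Mapping.keys (mono f) \<subseteq> {1..n}"
        by (auto simp: in_keys_iff mono split: if_splits)
      show "Poly_Mapping.lookup (mono f) i \<in> {1..<m}" if "i \<in> {1..n}" for i
        using f that by (auto simp: mono PiE_iff)
    qed
    then show "mono f \<in> Poly_Mapping.keys P"
      by (simp add: in_keys_iff)
  qed
  ultimately show ?thesis
    unfolding sparsity_def by (metis card_mono finite_keys)
qed

end
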